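(* Let $A$ be an atomic domain and $r>1$ an integer. Then $A$ is an $r$-congruence half-factorial domain ($r$-CHFD) if and only if every nonzero prime ideal of $A$ contains an $r$-good atom of $A$.
   Context: Domain means (commutative) integral domain. An atom (irreducible element) of a domain $A$ is a nonzero nonunit that is not a product of two nonunits of $A$. $A$ is atomic if every nonzero nonunit of $A$ is a product of finitely many atoms. For an integer $r>1$, an $r$-congruence half-factorial domain ($r$-CHFD) is an atomic domain $A$ such that for each nonzero nonunit $x\in A$ the lengths (numbers of factors) of all factorizations of $x$ into atoms are congruent modulo $r$. Let $A$ be an atomic domain and $r>1$ an integer. An atomic equality is an equality $a_1\cdots a_n=b_1\cdots b_m$ in which all factors $a_i,b_j$ are atoms of $A$ ($n,m\ge 1$). It is $r$-balanced if $n\equiv m \pmod r$ and $r$-unbalanced otherwise. It is irredundant if no proper subproduct of the $a$'s is associated to a proper subproduct of the $b$'s, i.e. $\prod_{i\in I}a_i$ is not associated (equal up to a unit factor of $A$) to $\prod_{j\in J}b_j$ for all nonempty proper subsets $I\subsetneq\{1,\dots,n\}$, $J\subsetneq\{1,\dots,m\}$. An $r$-bad atom is an atom that appears (as one of the $a_i$ or $b_j$) in some irredundant $r$-unbalanced atomic equality. An $r$-good atom is an atom that is not $r$-bad. *)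

theory Defs
  imports "HOL-Algebra.Ring_Divisibility" "HOL-Number_Theory.Cong"
begin

(* For a domain R, ring_irreducible says: nonzero, not a unit, and not a product of two
   nonunits (see atoms_iff below); it does not itself require membership in the carrier. *)
definition atoms :: "('a, 'b) ring_scheme \<Rightarrow> 'a set" where
  "atoms R = {a \<in> carrier R. ring_irreducible\<^bsub>R\<^esub> a}"

lemma atoms_iff:
  assumes "domain R"
  shows "a \<in> atoms R \<longleftrightarrow> a \<in> carrier R \<and> a \<noteq> \<zero>\<^bsub>R\<^esub> \<and> a \<notin> Units R \<and>
    \<not> (\<exists>b \<in> carrier R - Units R. \<exists>c \<in> carrier R - Units R. a = b \<otimes>\<^bsub>R\<^esub> c)"
proof
  assume "a \<in> atoms R"
  then show "a \<in> carrier R \<and> a \<noteq> \<zero>\<^bsub>R\<^esub> \<and> a \<notin> Units R \<and>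
      \<not> (\<exists>b \<in> carrier R - Units R. \<exists>c \<in> carrier R - Units R. a = b \<otimes>\<^bsub>R\<^esub> c)"
    using domain.ring_irreducibleE[OF assms, of a] unfolding atoms_def by blast
next
  assume *: "a \<in> carrier R \<and> a \<noteq> \<zero>\<^bsub>R\<^esub> \<and> a \<notin> Units R \<and>
      \<not> (\<exists>b \<in> carrier R - Units R. \<exists>c \<in> carrier R - Units R. a = b \<otimes>\<^bsub>R\<^esub> c)"
  then have "ring_irreducible\<^bsub>R\<^esub> a"
    by (intro domain.ring_irreducibleI[OF assms]) blast+
  with * show "a \<in> atoms R" unfolding atoms_def by blast
qed

(* Lists of factors are indexed from 0; for I = {..<length as} this is the full product. *)
definition subproduct :: "('a, 'b) ring_scheme \<Rightarrow> 'a list \<Rightarrow> nat set \<Rightarrow> 'a" where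
  "subproduct R as I = (\<Otimes>\<^bsub>R\<^esub>i\<in>I. as ! i)"

definition atomic_factorization :: "('a, 'b) ring_scheme \<Rightarrow> 'a list \<Rightarrow> 'a \<Rightarrow> bool" where
  "atomic_factorization R as x \<longleftrightarrow>
    set as \<subseteq> atoms R \<and> subproduct R as {..<length as} = x"

definition atomic_domain :: "('a, 'b) ring_scheme \<Rightarrow> bool" where
  "atomic_domain R \<longleftrightarrow> domain R \<and>
    (\<forall>x \<in> carrier R. x \<noteq> \<zero>\<^bsub>R\<^esub> \<longrightarrow> x \<notin> Units R \<longrightarrow> (\<exists>as. atomic_factorization R as x))"

definition CHFD :: "nat \<Rightarrow> ('a, 'b) ring_scheme \<Rightarrow> bool" where
  "CHFD r R \<longleftrightarrow> atomic_domain R \<and>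
    (\<forall>x \<in> carrier R. x \<noteq> \<zero>\<^bsub>R\<^esub> \<longrightarrow> x \<notin> Units R \<longrightarrow>
      (\<forall>as bs. atomic_factorization R as x \<longrightarrow> atomic_factorization R bs x \<longrightarrow>
        [length as = length bs] (mod r)))"

definition atomic_equality :: "('a, 'b) ring_scheme \<Rightarrow> 'a list \<Rightarrow> 'a list \<Rightarrow> bool" where
  "atomic_equality R as bs \<longleftrightarrow> as \<noteq> [] \<and> bs \<noteq> [] \<and>
    set as \<subseteq> atoms R \<and> set bs \<subseteq> atoms R \<and>
    subproduct R as {..<length as} = subproduct R bs {..<length bs}"

definition balanced :: "nat \<Rightarrow> 'a list \<Rightarrow> 'a list \<Rightarrow> bool" where
  "balanced r as bs \<longleftrightarrow> [length as = length bs] (mod r)"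

(* In a domain the library's relation of being associated is equality up to a unit factor:
   domain.ring_associated_iff. *)
definition irredundant :: "('a, 'b) ring_scheme \<Rightarrow> 'a list \<Rightarrow> 'a list \<Rightarrow> bool" where
  "irredundant R as bs \<longleftrightarrow>
    (\<forall>I J. I \<noteq> {} \<longrightarrow> I \<subset> {..<length as} \<longrightarrow> J \<noteq> {} \<longrightarrow> J \<subset> {..<length bs} \<longrightarrow>
      \<not> (subproduct R as I \<sim>\<^bsub>R\<^esub> subproduct R bs J))"

definition bad_atom :: "nat \<Rightarrow> ('a, 'b) ring_scheme \<Rightarrow> 'a \<Rightarrow> bool" where
  "bad_atom r R p \<longleftrightarrow>
    (\<exists>as bs. atomic_equality R as bs \<and> irredundant R as bs \<and> \<not> balanced r as bs \<and>
      p \<in> set as \<union> set bs)"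

definition good_atom :: "nat \<Rightarrow> ('a, 'b) ring_scheme \<Rightarrow> 'a \<Rightarrow> bool" where
  "good_atom r R p \<longleftrightarrow> p \<in> atoms R \<and> \<not> bad_atom r R p"

end

theory Submission
  imports Defs
begin

text \<open>
  If the domain is \<open>r\<close>-CHFD, there are no \<open>r\<close>-bad atoms, and a prime ideal containing a nonzero
  element contains one of its atomic factors. Conversely, let every nonzero prime ideal contain a good
  atom. A prime ideal maximal among the ideals disjoint from the multiplicative set of products of
  good atoms must be zero, so every nonzero element divides a product of good atoms. An atomic
  equality one side of which consists of good atoms is balanced: a shortest unbalanced one would be
  redundant, and cancelling associated subproducts would split it into two shorter equalities of the
  same kind, one of them unbalanced. Completing two factorizations of an element by the same
  cofactor to a product of good atoms shows that their lengths are congruent.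
\<close>

section \<open>Prime ideals disjoint from a multiplicative set\<close>

text \<open>Zorn's lemma gives an ideal \<open>P\<close> maximal among those containing
  \<open>I\<close> and avoiding \<open>S\<close>. For \<open>a\<close> and \<open>b\<close> outside
  \<open>P\<close>, both \<open>P + (a)\<close> and \<open>P + (b)\<close> meet \<open>S\<close>; if
  \<open>a \<otimes> b\<close> were in \<open>P\<close>, the product of two such elements would lie
  in both \<open>P\<close> and \<open>S\<close>.\<close>

lemma (in cring) exists_primeideal_disjoint:
  assumes I: "ideal I R" and S: "S \<subseteq> carrier R" "\<one> \<in> S"
    and mult: "\<And>s t. s \<in> S \<Longrightarrow> t \<in> S \<Longrightarrow> s \<otimes> t \<in> S"
    and disj: "I \<inter> S = {}"
  shows "\<exists>P. primeideal P R \<and> I \<subseteq> P \<and> P \<inter> S = {}"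
proof -
  let ?F = "{J. ideal J R \<and> I \<subseteq> J \<and> J \<inter> S = {}}"
  have "\<exists>P\<in>?F. \<forall>X\<in>?F. P \<subseteq> X \<longrightarrow> X = P"
  proof (rule subset_Zorn_nonempty)
    show "?F \<noteq> {}" using I disj by blast
  next
    fix C assume C: "C \<noteq> {}" "subset.chain ?F C"
    have "subset.chain {J. ideal J R} C"
      using C(2) unfolding pred_on.chain_def by auto
    then have "ideal (\<Union>C) R" using chain_Union_is_ideal[of C] C(1) by simp
    moreover have "C \<subseteq> ?F" using C(2) unfolding pred_on.chain_def by blast
    ultimately show "\<Union>C \<in> ?F" using C(1) by blast
  qed
  then obtain P where P: "ideal P R" "I \<subseteq> P" "P \<inter> S = {}"
    and max: "\<And>X. ideal X R \<Longrightarrow> P \<subseteq> X \<Longrightarrow> X \<inter> S = {} \<Longrightarrow> X = P"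
    by (auto dest: order_trans)
  interpret P: ideal P R by (rule P(1))
  have meets: "\<exists>p\<in>P. \<exists>c\<in>carrier R. p \<oplus> c \<otimes> a \<in> S" if a: "a \<in> carrier R" "a \<notin> P" for a
  proof -
    let ?X = "P <+>\<^bsub>R\<^esub> PIdl a"
    have X: "ideal ?X R" by (rule add_ideals[OF P(1) cgenideal_ideal[OF a(1)]])
    have mem: "p \<oplus> c \<otimes> a \<in> ?X" if "p \<in> P" "c \<in> carrier R" for p c
      using that unfolding set_add_def' cgenideal_def by blast
    have "P \<subseteq> ?X"
    proof
      fix p assume "p \<in> P"
      then show "p \<in> ?X" using mem[of p \<zero>] a(1) P.a_subset by auto
    qed
    moreover have "a \<in> ?X" using mem[of \<zero> \<one>] a(1) by simp
    ultimately have "?X \<inter> S \<noteq> {}" using max[OF X] a(2) by blast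
    then show ?thesis unfolding set_add_def' cgenideal_def by blast
  qed
  have "primeideal P R"
  proof (rule primeidealI[OF P(1)])
    show "cring R" by (rule is_cring)
    show "carrier R \<noteq> P" using P(3) S by blast
    fix a b assume ab: "a \<in> carrier R" "b \<in> carrier R" "a \<otimes> b \<in> P"
    show "a \<in> P \<or> b \<in> P"
    proof (rule ccontr)
      assume "\<not> (a \<in> P \<or> b \<in> P)"
      then obtain p c q d where pq: "p \<in> P" "c \<in> carrier R" "p \<oplus> c \<otimes> a \<in> S"
        "q \<in> P" "d \<in> carrier R" "q \<oplus> d \<otimes> b \<in> S"
        using meets[OF ab(1)] meets[OF ab(2)] by blast
      have car: "p \<in> carrier R" "q \<in> carrier R" using pq P.a_subset by blast+
      \<comment> \<open>The expansion is grouped so that each summand is a multiple of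
        \<open>p\<close>, \<open>q\<close> or \<open>a \<otimes> b\<close>, all of which lie in
        \<open>P\<close>.\<close>
      have "(p \<oplus> c \<otimes> a) \<otimes> (q \<oplus> d \<otimes> b)
          = (q \<oplus> d \<otimes> b) \<otimes> p \<oplus> ((c \<otimes> a) \<otimes> q \<oplus> (c \<otimes> d) \<otimes> (a \<otimes> b))"
        using car ab pq by algebra
      also have "\<dots> \<in> P"
      proof (intro P.a_closed)
        show "(q \<oplus> d \<otimes> b) \<otimes> p \<in> P" "(c \<otimes> a) \<otimes> q \<in> P"
          using car ab pq by (auto intro: P.I_l_closed)
        show "(c \<otimes> d) \<otimes> (a \<otimes> b) \<in> P"
          using P.I_l_closed[OF ab(3)] pq by blast
      qed
      finally show False using mult[OF pq(3,6)] P(3) by blast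
    qed
  qed
  then show ?thesis using P by blast
qed

section \<open>Products of lists and of selected factors\<close>

text \<open>A fold over the list of factors permits induction and concatenation, while
  \<open>nths\<close> takes over the role of the index sets in \<open>subproduct\<close>.\<close>

abbreviation (in monoid) list_product :: "'a list \<Rightarrow> 'a" where
  "list_product as \<equiv> foldr (\<otimes>) as \<one>"

context comm_monoid
begin

lemma list_product_append:
  assumes "set as \<subseteq> carrier G" "set bs \<subseteq> carrier G"
  shows "list_product (as @ bs) = list_product as \<otimes> list_product bs"
  using assms by (induction as) (auto simp: m_assoc)

lemma list_product_nths_Compl:
  assumes "set as \<subseteq> carrier G"
  shows "list_product (nths as I) \<otimes> list_product (nths as (- I)) = list_product as"
  using assms
proof (induction as arbitrary: I)
  case (Cons a as)
  have "{j. Suc j \<in> - I} = - {j. Suc j \<in> I}" by auto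
  moreover have "set (nths as J) \<subseteq> carrier G" for J
    using Cons.prems set_nths_subset[of as J] by auto
  ultimately show ?case
    using Cons.prems Cons.IH[of "{j. Suc j \<in> I}"]
    by (auto simp: nths_Cons m_ac)
qed simp

end

lemma length_nths_Compl: "length (nths as I) + length (nths as (- I)) = length as"
proof (induction as arbitrary: I)
  case (Cons a as)
  have "{j. Suc j \<in> - I} = - {j. Suc j \<in> I}" by auto
  then show ?case using Cons[of "{j. Suc j \<in> I}"] by (auto simp: nths_Cons)
qed simp

lemma nths_eq_Nil_iff: "nths as I = [] \<longleftrightarrow> I \<inter> {..<length as} = {}"
proof -
  have "nths as I = [] \<longleftrightarrow> {i. i < length as \<and> i \<in> I} = {}"
    using length_nths[of as I] by (metis (no_types, lifting) card_0_eq finite_nat_set_iff_bounded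
      length_0_conv mem_Collect_eq)
  then show ?thesis by auto
qed

context cring
begin

text \<open>Induction from the right end leaves the indices of the earlier factors
  unchanged.\<close>

lemma subproduct_eq_list_product_nths:
  assumes "set as \<subseteq> carrier R" "I \<subseteq> {..<length as}"
  shows "subproduct R as I = list_product (nths as I)"
  using assms
proof (induction as arbitrary: I rule: rev_induct)
  case Nil
  then show ?case by (simp add: subproduct_def)
next
  case (snoc a as)
  let ?J = "I - {length as}"
  have J: "?J \<subseteq> {..<length as}" using snoc.prems by auto
  have "subproduct R (as @ [a]) ?J = subproduct R as ?J"
    unfolding subproduct_def using J snoc.prems
    by (intro finprod_cong') (auto simp: nth_append subset_iff)
  also have "\<dots> = list_product (nths as ?J)" using snoc J by auto
  \<comment> \<open>The index \<open>length as\<close> lies beyond the end of \<open>as\<close>, so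
    \<open>nths\<close> ignores it.\<close>
  also have "nths as ?J = nths as I" unfolding nths_def
    by (intro arg_cong[where f = "map fst"] filter_cong) (auto dest: set_zip_rightD)
  finally have *: "subproduct R (as @ [a]) ?J = list_product (nths as I)" .
  show ?case
  proof (cases "length as \<in> I")
    case True
    have car: "set (nths as I) \<subseteq> carrier R" "a \<in> carrier R"
      using snoc.prems set_nths_subset[of as I] by auto
    have "subproduct R (as @ [a]) I = subproduct R (as @ [a]) (insert (length as) ?J)"
      using True by (simp add: insert_absorb)
    also have "\<dots> = a \<otimes> subproduct R (as @ [a]) ?J"
      unfolding subproduct_def using finite_subset[OF J] J snoc.prems
        finprod_insert[of ?J "length as" "\<lambda>i. (as @ [a]) ! i"]
      by (auto simp: nth_append subset_iff Pi_iff simp del: insert_Diff_single)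
    finally show ?thesis
      using True car by (simp add: * nths_append list_product_append m_comm del: foldr_append)
  next
    case False
    then show ?thesis using * by (simp add: nths_append)
  qed
qed

lemma subproduct_eq_list_product:
  assumes "set as \<subseteq> carrier R"
  shows "subproduct R as {..<length as} = list_product as"
  using subproduct_eq_list_product_nths[OF assms, of "{..<length as}"] by (simp add: nths_all)

end

lemma (in primeideal) list_product_mem:
  assumes "set as \<subseteq> carrier R" "list_product as \<in> I"
  shows "\<exists>a\<in>set as. a \<in> I"
  using assms
proof (induction as)
  case Nil
  then show ?case using one_imp_carrier I_notcarr by auto
next
  case (Cons a as)
  then show ?case using I_prime[of a "list_product as"] by auto
qed

section \<open>Products of atoms and units\<close>

context domain
begin

lemma atoms_subset: "atoms R \<subseteq> carrier R - {\<zero>}"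
  unfolding atoms_def ring_irreducible_def by blast

lemma list_product_atoms:
  assumes "set as \<subseteq> atoms R"
  shows "list_product as \<in> carrier R - {\<zero>}"
  using assms atoms_subset by (induction as) (auto simp: integral_iff subset_iff)

lemma list_product_atoms_not_Unit:
  assumes "set as \<subseteq> atoms R" "as \<noteq> []"
  shows "list_product as \<notin> Units R"
proof (cases as)
  case (Cons a as')
  then have "a \<in> carrier R" "a \<notin> Units R" "list_product as' \<in> carrier R"
    using assms list_product_atoms[of as'] by (auto simp: atoms_iff[OF domain_axioms])
  then show ?thesis using Cons unit_factor[of a "list_product as'"] by auto
qed (use assms in simp)

text \<open>A nonempty product of atoms is a nonunit, whereas the empty product is
  \<open>\<one>\<close>.\<close>

lemma list_product_eq_imp_nonempty:
  assumes "set as \<subseteq> atoms R" "set bs \<subseteq> atoms R" "list_product as = list_product bs" "as \<noteq> []"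
  shows "bs \<noteq> []"
  using list_product_atoms_not_Unit[OF assms(1,4)] assms(3) by auto

lemma Unit_mult_atom:
  assumes "u \<in> Units R" "a \<in> atoms R"
  shows "u \<otimes> a \<in> atoms R"
proof -
  have "u \<in> carrier R" "u \<noteq> \<zero>"
    using assms(1) Units_closed[OF assms(1)] Units_r_inv[OF assms(1)]
      Units_inv_closed[OF assms(1)] l_null[of "inv u"] zero_not_one by metis+
  moreover have "a \<in> carrier R" "a \<noteq> \<zero>" "Divisibility.irreducible R a"
    using assms(2) unfolding atoms_def ring_irreducible_def by auto
  ultimately show ?thesis
    using irreducible_prod_lI[of a u] assms(1)
    unfolding atoms_def ring_irreducible_def by (simp add: integral_iff)
qed

text \<open>The unit is absorbed into the first atom, which keeps the number of factors; an empty
  product has no factor to absorb it.\<close>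

lemma Unit_mult_list_product:
  assumes "u \<in> Units R" "set as \<subseteq> atoms R" "as \<noteq> []"
  shows "\<exists>as'. set as' \<subseteq> atoms R \<and> length as' = length as \<and>
    list_product as' = u \<otimes> list_product as"
proof (cases as)
  case (Cons a bs)
  have "a \<in> carrier R" "list_product bs \<in> carrier R"
    using assms Cons atoms_subset list_product_atoms[of bs] by auto
  then show ?thesis
    using assms Cons Unit_mult_atom[of u a]
    by (intro exI[of _ "(u \<otimes> a) # bs"]) (auto simp: m_assoc)
qed (use assms in simp)

section \<open>Atomic equalities and their splitting\<close>

lemma atomic_factorization_iff:
  "atomic_factorization R as x \<longleftrightarrow> set as \<subseteq> atoms R \<and> list_product as = x"
proof -
  have "set as \<subseteq> atoms R \<Longrightarrow> set as \<subseteq> carrier R" using atoms_subset by blast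
  then show ?thesis unfolding atomic_factorization_def using subproduct_eq_list_product by auto
qed

lemma atomic_equality_iff:
  "atomic_equality R as bs \<longleftrightarrow> as \<noteq> [] \<and> bs \<noteq> [] \<and> set as \<subseteq> atoms R \<and> set bs \<subseteq> atoms R \<and>
    list_product as = list_product bs"
proof -
  have "set cs \<subseteq> atoms R \<Longrightarrow> set cs \<subseteq> carrier R" for cs using atoms_subset by blast
  then show ?thesis unfolding atomic_equality_def using subproduct_eq_list_product by auto
qed

text \<open>The units relating the associated subproducts are absorbed into the factors on the left only,
  so the factors on the right remain among the original ones.\<close>

lemma redundant_equality_splits:
  assumes eq: "atomic_equality R as bs" and red: "\<not> irredundant R as bs"
  obtains as1 bs1 as2 bs2 where
    "atomic_equality R as1 bs1" "atomic_equality R as2 bs2"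
    "set bs1 \<subseteq> set bs" "set bs2 \<subseteq> set bs"
    "length as1 + length as2 = length as" "length bs1 + length bs2 = length bs"
proof -
  have at: "set as \<subseteq> atoms R" "set bs \<subseteq> atoms R" "list_product as = list_product bs"
    using eq by (auto simp: atomic_equality_iff)
  then have car: "set as \<subseteq> carrier R" "set bs \<subseteq> carrier R" using atoms_subset by auto
  obtain I J where IJ: "I \<noteq> {}" "I \<subset> {..<length as}" "J \<noteq> {}" "J \<subset> {..<length bs}"
    and assoc: "subproduct R as I \<sim> subproduct R bs J"
    using red unfolding irredundant_def by blast
  let ?a = "list_product (nths as I)" and ?a' = "list_product (nths as (- I))"
  let ?b = "list_product (nths bs J)" and ?b' = "list_product (nths bs (- J))"
  have sub: "set (nths as K) \<subseteq> atoms R" "set (nths bs K) \<subseteq> atoms R" for K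
    using at set_nths_subset[of as K] set_nths_subset[of bs K] by auto
  \<comment> \<open>Properness of \<open>I\<close> and \<open>J\<close> makes the complementary
    pieces nonempty as well.\<close>
  have ne: "nths as I \<noteq> []" "nths as (- I) \<noteq> []" "nths bs J \<noteq> []" "nths bs (- J) \<noteq> []"
    using IJ unfolding nths_eq_Nil_iff by blast+
  have closed: "?a \<in> carrier R - {\<zero>}" "?a' \<in> carrier R" "?b \<in> carrier R" "?b' \<in> carrier R"
    using list_product_atoms sub by blast+
  have "?b \<sim> ?a"
    using assoc IJ subproduct_eq_list_product_nths[OF car(1), of I]
      subproduct_eq_list_product_nths[OF car(2), of J] by (simp add: associated_sym)
  then obtain u where u: "u \<in> Units R" "?b = u \<otimes> ?a"
    using ring_associated_iff closed by auto
  \<comment> \<open>Cancelling \<open>?a\<close> shows that the complementary products differ by the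
    same unit in the opposite direction, so the left pieces must be scaled by \<open>u\<close> and
    by \<open>inv u\<close>.\<close>
  have "?a \<otimes> ?a' = ?b \<otimes> ?b'"
    using list_product_nths_Compl[OF car(1), of I] list_product_nths_Compl[OF car(2), of J] at
    by simp
  also have "\<dots> = ?a \<otimes> (u \<otimes> ?b')"
    using u closed by (simp add: m_ac Units_closed)
  finally have "?a' = u \<otimes> ?b'"
    using m_lcancel[of ?a ?a' "u \<otimes> ?b'"] u closed by auto
  then have u': "?b' = inv u \<otimes> ?a'"
    using u closed by (simp add: m_assoc[symmetric] Units_closed)
  obtain as1 as2 where
    as1: "set as1 \<subseteq> atoms R" "length as1 = length (nths as I)" "list_product as1 = u \<otimes> ?a" and
    as2: "set as2 \<subseteq> atoms R" "length as2 = length (nths as (- I))" "list_product as2 = inv u \<otimes> ?a'"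
    using Unit_mult_list_product[of u "nths as I"]
      Unit_mult_list_product[of "inv u" "nths as (- I)"] u sub ne by (auto simp del: length_nths)
  have "atomic_equality R as1 (nths bs J)" "atomic_equality R as2 (nths bs (- J))"
    unfolding atomic_equality_iff using as1 as2 u u' sub ne by (auto simp del: length_0_conv)
  moreover have "length as1 + length as2 = length as"
    using as1 as2 length_nths_Compl[of as I] by simp
  ultimately show ?thesis
    using that[of as1 "nths bs J" as2 "nths bs (- J)"]
    by (simp only: set_nths_subset length_nths_Compl simp_thms)
qed

text \<open>Goodness is asked only of the right side, because its pieces inherit it from
  \<open>gs\<close> when a redundant equality splits.\<close>

lemma good_equality_balanced:
  assumes "atomic_equality R as gs" "\<forall>g\<in>set gs. good_atom r R g"
  shows "balanced r as gs"
  using assms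
proof (induction "length as + length gs" arbitrary: as gs rule: less_induct)
  case less
  show ?case
  proof (cases "irredundant R as gs")
    case True
    \<comment> \<open>Any right-hand factor will do: being good, it cannot occur in an irredundant
      unbalanced equality.\<close>
    have "hd gs \<in> set gs" using less.prems by (simp add: atomic_equality_iff)
    then show ?thesis
      using True less.prems unfolding good_atom_def bad_atom_def by blast
  next
    case False
    obtain as1 gs1 as2 gs2 where *:
      "atomic_equality R as1 gs1" "atomic_equality R as2 gs2"
      "set gs1 \<subseteq> set gs" "set gs2 \<subseteq> set gs"
      "length as1 + length as2 = length as" "length gs1 + length gs2 = length gs"
      using redundant_equality_splits[OF less.prems(1) False] .
    \<comment> \<open>Both left pieces being nonempty, each of them is strictly shorter than
      \<open>as\<close>.\<close>
    have "length as1 > 0" "length as2 > 0" using * by (auto simp: atomic_equality_iff)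
    then have "length as1 + length gs1 < length as + length gs"
      "length as2 + length gs2 < length as + length gs" using *(5,6) by linarith+
    then have "balanced r as1 gs1" "balanced r as2 gs2"
      using * less.prems(2) by (auto intro!: less.hyps)
    then show ?thesis
      unfolding balanced_def *(5,6)[symmetric] by (rule cong_add)
  qed
qed

section \<open>Divisors of products of good atoms\<close>

text \<open>If \<open>x\<close> divides no product of good atoms, then \<open>PIdl x\<close> misses
  the set \<open>?S\<close> of these products, and so does some prime ideal containing
  \<open>x\<close>. As \<open>x\<close> is nonzero, this prime contains a good atom, which is itself
  a one-factor element of \<open>?S\<close>.\<close>

lemma divides_good_product:
  assumes primes: "\<forall>P. primeideal P R \<longrightarrow> P \<noteq> {\<zero>} \<longrightarrow> (\<exists>p\<in>P. good_atom r R p)"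
    and x: "x \<in> carrier R" "x \<noteq> \<zero>"
  shows "\<exists>gs. (\<forall>g\<in>set gs. good_atom r R g) \<and> x divides list_product gs"
proof (rule ccontr)
  assume none: "\<not> ?thesis"
  let ?S = "list_product ` {gs. \<forall>g\<in>set gs. good_atom r R g}"
  have carr: "set gs \<subseteq> carrier R" if "\<forall>g\<in>set gs. good_atom r R g" for gs
    using that atoms_subset unfolding good_atom_def by blast
  have "PIdl x \<inter> ?S = {}"
  proof (rule ccontr)
    assume "PIdl x \<inter> ?S \<noteq> {}"
    then obtain c gs where "c \<in> carrier R" "\<forall>g\<in>set gs. good_atom r R g" "list_product gs = c \<otimes> x"
      unfolding cgenideal_def by auto
    then show False using none x m_comm[of c x] by (auto simp: factor_def)
  qed
  moreover have "?S \<subseteq> carrier R" using carr by auto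
  moreover have "\<one> \<in> ?S" by (rule image_eqI[of _ _ "[]"]) auto
  moreover have "s \<otimes> t \<in> ?S" if "s \<in> ?S" "t \<in> ?S" for s t
  proof -
    obtain fs gs where fg: "\<forall>g\<in>set fs. good_atom r R g" "\<forall>g\<in>set gs. good_atom r R g"
      "s = list_product fs" "t = list_product gs" using \<open>s \<in> ?S\<close> \<open>t \<in> ?S\<close> by blast
    then have "s \<otimes> t = list_product (fs @ gs)" using carr by (simp add: list_product_append del: foldr_append)
    then show ?thesis using fg by (intro image_eqI[of _ _ "fs @ gs"]) auto
  qed
  ultimately obtain P where P: "primeideal P R" "PIdl x \<subseteq> P" "P \<inter> ?S = {}"
    using exists_primeideal_disjoint[OF cgenideal_ideal[OF x(1)], of ?S] by blast
  have "x \<in> P" using P cgenideal_self[OF x(1)] by blast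
  then obtain p where p: "p \<in> P" "good_atom r R p" using primes P x by blast
  then have "p \<in> carrier R" using carr[of "[p]"] by simp
  then have "p \<in> ?S" using p by (intro image_eqI[of _ _ "[p]"]) auto
  then show False using p P by blast
qed

end

theorem theorem14:
  fixes R :: "('a, 'b) ring_scheme" (structure) and r :: nat
  assumes "atomic_domain R" and "r > 1"
  shows "CHFD r R \<longleftrightarrow>
    (\<forall>P. primeideal P R \<longrightarrow> P \<noteq> {\<zero>} \<longrightarrow> (\<exists>p \<in> P. good_atom r R p))"
proof -
  interpret domain R using assms(1) unfolding atomic_domain_def by blast
  have factorization: "\<exists>as. set as \<subseteq> atoms R \<and> list_product as = x"
    if "x \<in> carrier R" "x \<noteq> \<zero>" "x \<notin> Units R" for x
    using assms(1) that unfolding atomic_domain_def atomic_factorization_iff by blast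
  show ?thesis
  proof (intro iffI allI impI)
    fix P assume CHFD: "CHFD r R" and P: "primeideal P R" "P \<noteq> {\<zero>}"
    interpret P: primeideal P R by (rule P(1))
    \<comment> \<open>The two sides factor one nonzero nonunit, so CHFD rules out unbalanced
      equalities and hence bad atoms.\<close>
    have "balanced r as bs" if "atomic_equality R as bs" for as bs
    proof -
      have at: "as \<noteq> []" "set as \<subseteq> atoms R" "set bs \<subseteq> atoms R" "list_product bs = list_product as"
        using that by (auto simp: atomic_equality_iff)
      then show ?thesis
        using CHFD list_product_atoms[OF at(2)] list_product_atoms_not_Unit[OF at(2,1)]
        unfolding CHFD_def balanced_def atomic_factorization_iff by blast
    qed
    then have good: "good_atom r R p" if "p \<in> atoms R" for p
      using that unfolding good_atom_def bad_atom_def by blast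
    obtain x where x: "x \<in> P" "x \<noteq> \<zero>" using P(2) P.zero_closed by blast
    have xR: "x \<in> carrier R" using x P.a_subset by blast
    have "x \<notin> Units R"
    proof
      assume "x \<in> Units R"
      then have "\<one> \<in> P" using P.I_l_closed[OF x(1), of "inv x"] by simp
      then show False using P.one_imp_carrier P.I_notcarr by simp
    qed
    then obtain as where as: "set as \<subseteq> atoms R" "list_product as = x"
      using factorization xR x by blast
    then have "\<exists>a\<in>set as. a \<in> P" using P.list_product_mem[of as] atoms_subset x by auto
    then show "\<exists>p\<in>P. good_atom r R p" using good as by blast
  next
    assume primes: "\<forall>P. primeideal P R \<longrightarrow> P \<noteq> {\<zero>} \<longrightarrow> (\<exists>p\<in>P. good_atom r R p)"
    have "[length as = length bs] (mod r)"
      if x: "x \<in> carrier R" "x \<noteq> \<zero>" "x \<notin> Units R"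
        and as: "set as \<subseteq> atoms R" "list_product as = x"
        and bs: "set bs \<subseteq> atoms R" "list_product bs = x" for x as bs
    proof -
      \<comment> \<open>Using a multiple of \<open>x \<otimes> x\<close> makes the cofactor of \<open>x\<close> a nonunit, so that it has a factorization.\<close>
      obtain gs where gs: "\<forall>g\<in>set gs. good_atom r R g" "(x \<otimes> x) divides list_product gs"
        using divides_good_product[OF primes, of "x \<otimes> x"] x by (auto simp: integral_iff)
      have gs_at: "set gs \<subseteq> atoms R" using gs unfolding good_atom_def by blast
      obtain y where y: "y \<in> carrier R" "list_product gs = x \<otimes> x \<otimes> y"
        using gs(2) unfolding factor_def by blast
      have "y \<noteq> \<zero>" using list_product_atoms[OF gs_at] y x by auto
      then obtain cs where cs: "set cs \<subseteq> atoms R" "list_product cs = x \<otimes> y"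
        using factorization[of "x \<otimes> y"] unit_factor[of x y] x y by (auto simp: integral_iff)
      \<comment> \<open>The same \<open>cs\<close> extends every factorization of \<open>x\<close>
        to one of the fixed product of \<open>gs\<close>, which determines its length modulo
        \<open>r\<close>.\<close>
      have cong: "[length ds + length cs = length gs] (mod r)"
        if ds: "set ds \<subseteq> atoms R" "list_product ds = x" for ds
      proof -
        have "list_product (ds @ cs) = list_product gs"
          using ds cs y x atoms_subset by (subst list_product_append) (auto simp: m_assoc subset_iff)
        moreover have "ds \<noteq> []" using ds x by auto
        ultimately have "atomic_equality R (ds @ cs) gs"
          using ds cs gs_at list_product_eq_imp_nonempty[of "ds @ cs" gs]
          unfolding atomic_equality_iff by auto
        then show ?thesis using good_equality_balanced gs(1) unfolding balanced_def by fastforce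
      qed
      have "[length as + length cs = length bs + length cs] (mod r)"
        using cong[OF as] cong[OF bs] cong_sym cong_trans by blast
      then show ?thesis by (simp add: cong_add_rcancel_nat)
    qed
    then show "CHFD r R" using assms(1) unfolding CHFD_def atomic_factorization_iff by blast
  qed
qed

end
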